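(* Let $D^{\mathcal I_1}\subset\mathbb R^{\mathcal I_1}$ and $D^{\mathcal I_2}\subset\mathbb R^{\mathcal I_2}$, and let $q_i:\mathbb R^{\mathcal I_1}\times\mathbb R\to\mathbb R$ ($i\in\mathcal J_1$), $q_i:\mathbb R^{\mathcal I_2}\times\mathbb R\to\mathbb R$ ($i\in\mathcal J_2$), $h_1:D^{\mathcal I_1}\times\mathbb R\to\mathbb R$ and $h_2:D^{\mathcal I_2}\to\mathbb R$ be continuous. Suppose that $q_i(x_{\mathcal I_2},z)$ is quasiconvex with respect to $z$ for all $x_{\mathcal I_2}\in\mathbb R^{\mathcal I_2}$, $i\in\mathcal J_2$, and that $z_0\in\mathbb R$ is such that $q_i(x_{\mathcal I_2},z_0)\le 0$ for all $x_{\mathcal I_2}\in D^{\mathcal I_2}$, $i\in\mathcal J_2$. Then, for every $q_0:D^{\mathcal I_1}\times\mathbb R\to\mathbb R$, the optimal value of $$\begin{aligned}\max_{x_{\mathcal I_1}\in D^{\mathcal I_1},\ x_{\mathcal I_2}\in D^{\mathcal I_2},\ y_1\in\mathbb R,\ y_2\in\mathbb R}\ & q_0(x_{\mathcal I_1},y_2)\\ \text{subject to}\quad & q_i(x_{\mathcal I_1},y_2)\le 0\ \ \forall i\in\mathcal J_1,\quad q_i(x_{\mathcal I_2},y_1)\le 0\ \ \forall i\in\mathcal J_2,\\ & y_1=h_1(x_{\mathcal I_1},y_2),\quad y_2=h_2(x_{\mathcal I_2})\end{aligned}$$ is equal to the optimal value of $$\begin{aligned}\max_{x_{\mathcal I_1}\in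 D^{\mathcal I_1},\ y_2\in D_2}\ & q_0(x_{\mathcal I_1},y_2)\\ \text{subject to}\quad & q_i(x_{\mathcal I_1},y_2)\le 0\ \ \forall i\in\mathcal J_1,\quad g^l(y_2)\le h_1(x_{\mathcal I_1},y_2)\le g^u(y_2),\end{aligned}$$ where $D_2:=h_2(D^{\mathcal I_2})$, $g^l(y_2):=\min G(y_2)$, $g^u(y_2):=\max G(y_2)$, and $$G(y_2):=\{z\in\mathbb R:\ \exists\, x_{\mathcal I_2}\in D^{\mathcal I_2}\text{ with }h_2(x_{\mathcal I_2})=y_2\text{ and }q_i(x_{\mathcal I_2},z)\le 0\ \forall i\in\mathcal J_2\}.$$
   Context: $\{\mathcal I_1,\mathcal I_2\}$ is a partition of $\{1,\dots,n\}$ and $\{\mathcal J_1,\mathcal J_2\}$ is a partition of $\{1,\dots,m\}$. $x_{\mathcal I_1},x_{\mathcal I_2}$ are the subvectors of $x\in D\subset\mathbb R^n$ indexed by $\mathcal I_1,\mathcal I_2$, and $D^{\mathcal I_1},D^{\mathcal I_2}$ are their domains. A function $\psi:X\to\mathbb R$ is quasiconvex if $\psi(\theta x_1+(1-\theta)x_2)\le\max\{\psi(x_1),\psi(x_2)\}$ for all $x_1,x_2\in X$, $\theta\in[0,1]$. Since $G(y_2)$ may be unbounded, $g^l(y_2)=-\infty$ and $g^u(y_2)=+\infty$ are allowed (the corresponding constraint is then vacuous). Optimal values are suprema if not attained.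
   Formalization: It is additionally assumed that, for every y_2 in D_2, G(y_2) attains its minimum if it is bounded below and its maximum if it is bounded above, so that g^l and g^u are defined; without this min G(y_2) need not exist (e.g. G = (0,∞)). *)

theory Defs
  imports "HOL-Analysis.Analysis"
begin

text \<open>
  The space of real vectors indexed by a finite set \<open>I\<close> of naturals, as extensional functions.
  In the product topology on \<^typ>\<open>nat \<Rightarrow> real\<close>, which is what \<^const>\<open>continuous_on\<close> refers to,
  this subspace carries the usual Euclidean topology.
\<close>

definition vecs :: "nat set \<Rightarrow> (nat \<Rightarrow> real) set" where
  "vecs I = PiE I (\<lambda>_. UNIV)"

definition quasiconvex_on :: "'a::real_vector set \<Rightarrow> ('a \<Rightarrow> real) \<Rightarrow> bool" where
  "quasiconvex_on X \<psi> \<longleftrightarrow>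
     (\<forall>x\<^sub>1\<in>X. \<forall>x\<^sub>2\<in>X. \<forall>\<theta>\<in>{0..1}.
        \<psi> (\<theta> *\<^sub>R x\<^sub>1 + (1 - \<theta>) *\<^sub>R x\<^sub>2) \<le> max (\<psi> x\<^sub>1) (\<psi> x\<^sub>2))"

text \<open>
  Minimum and maximum, with infinite values for unbounded sets. As \<^const>\<open>Least\<close> is unspecified
  without a least element, \<open>ext_min S\<close> is meaningful only if \<open>has_ext_min S\<close>; likewise for
  \<open>ext_max\<close>.
\<close>

definition has_ext_min :: "real set \<Rightarrow> bool" where
  "has_ext_min S \<longleftrightarrow> (bdd_below S \<longrightarrow> (\<exists>m\<in>S. \<forall>z\<in>S. m \<le> z))"

definition has_ext_max :: "real set \<Rightarrow> bool" where
  "has_ext_max S \<longleftrightarrow> (bdd_above S \<longrightarrow> (\<exists>m\<in>S. \<forall>z\<in>S. z \<le> m))"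

definition ext_min :: "real set \<Rightarrow> ereal" where
  "ext_min S = (if bdd_below S then ereal (LEAST z. z \<in> S) else - \<infinity>)"

definition ext_max :: "real set \<Rightarrow> ereal" where
  "ext_max S = (if bdd_above S then ereal (GREATEST z. z \<in> S) else \<infinity>)"

definition G_set ::
  "(nat \<Rightarrow> real) set \<Rightarrow> ((nat \<Rightarrow> real) \<Rightarrow> real) \<Rightarrow> nat set
     \<Rightarrow> (nat \<Rightarrow> (nat \<Rightarrow> real) \<Rightarrow> real \<Rightarrow> real) \<Rightarrow> real \<Rightarrow> real set" where
  "G_set D h J q y = {z. \<exists>x\<in>D. h x = y \<and> (\<forall>i\<in>J. q i x z \<le> 0)}"

text \<open>
  Optimal value of maximising \<open>f\<close> over the feasible set \<open>F\<close>: the supremum in the extended reals,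
  hence \<open>- \<infinity>\<close> for an infeasible problem.
\<close>

definition opt_value :: "'a set \<Rightarrow> ('a \<Rightarrow> real) \<Rightarrow> ereal" where
  "opt_value F f = (SUP p\<in>F. ereal (f p))"

end

theory Submission
  imports Defs
begin

text \<open>
  The first problem couples \<open>x\<^sub>1\<close> with \<open>x\<^sub>2\<close> and \<open>y\<^sub>1\<close> only through the two numbers \<open>y\<^sub>2\<close> and
  \<open>y\<^sub>1 = h\<^sub>1 x\<^sub>1 y\<^sub>2\<close>: a pair \<open>(x\<^sub>1, y\<^sub>2)\<close> extends to a feasible point exactly if it satisfies the
  constraints of \<open>J\<^sub>1\<close> and \<open>h\<^sub>1 x\<^sub>1 y\<^sub>2\<close> lies in \<open>G(y\<^sub>2)\<close>. The objective depends on \<open>(x\<^sub>1, y\<^sub>2)\<close> alone,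
  so the problem may be projected onto these variables without changing its value
  (\<open>opt_value_image\<close>).

  It remains to describe \<open>G(y\<^sub>2)\<close> by its two end points, which requires that \<open>G(y\<^sub>2)\<close> has no gaps.
  For a single \<open>x\<^sub>2\<close> the admissible \<open>z\<close> form an intersection of sublevel sets of quasiconvex
  functions, hence a convex set. A union of such sets over the \<open>x\<^sub>2\<close> in a fibre of \<open>h\<^sub>2\<close> need not be
  convex in general, but here all of them contain \<open>z\<^sub>0\<close>, so that the union is connected, and a
  connected set of reals is an interval (\<open>is_interval_G_set\<close>). An interval that attains its
  finite end points consists of the numbers between its minimum and maximum
  (\<open>mem_iff_between_ext_min_ext_max\<close>).
\<close>

lemma opt_value_image: "opt_value (p ` F) f = opt_value F (\<lambda>x. f (p x))"
  unfolding opt_value_def by (simp add: image_image)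

lemma convex_sublevel_set_quasiconvex:
  assumes "quasiconvex_on UNIV \<psi>"
  shows "convex {z. \<psi> z \<le> c}"
proof (rule convexI)
  fix x y :: 'a and u v :: real
  assume xy: "x \<in> {z. \<psi> z \<le> c}" "y \<in> {z. \<psi> z \<le> c}" and uv: "0 \<le> u" "0 \<le> v" "u + v = 1"
  have "u \<in> {0..1}" "v = 1 - u" using uv by auto
  then have "\<psi> (u *\<^sub>R x + v *\<^sub>R y) \<le> max (\<psi> x) (\<psi> y)"
    using assms unfolding quasiconvex_on_def by blast
  then show "u *\<^sub>R x + v *\<^sub>R y \<in> {z. \<psi> z \<le> c}" using xy by auto
qed

text \<open>
  The common feasible value \<open>z\<^sub>0\<close> ties the convex slices belonging to the different \<open>x\<close> together.
\<close>

lemma is_interval_G_set: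
  assumes qc: "\<And>i x. i \<in> J \<Longrightarrow> x \<in> D \<Longrightarrow> quasiconvex_on UNIV (\<lambda>z. q i x z)"
    and z\<^sub>0: "\<And>i x. i \<in> J \<Longrightarrow> x \<in> D \<Longrightarrow> q i x z\<^sub>0 \<le> 0"
  shows "is_interval (G_set D h J q y)"
proof -
  define slice where "slice x = (\<Inter>i\<in>J. {z. q i x z \<le> 0})" for x
  have "connected (slice x)" if "x \<in> D" for x
    unfolding slice_def
    using that by (intro convex_connected convex_INT convex_sublevel_set_quasiconvex qc)
  moreover have "z\<^sub>0 \<in> slice x" if "x \<in> D" for x
    unfolding slice_def using that z\<^sub>0 by auto
  ultimately have "connected (\<Union>(slice ` {x\<in>D. h x = y}))"
    by (intro connected_Union) blast+
  moreover have "G_set D h J q y = \<Union>(slice ` {x\<in>D. h x = y})"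
    unfolding G_set_def slice_def by auto
  ultimately show ?thesis by (simp add: is_interval_connected_1)
qed

text \<open>
  Comparing with an element of \<open>S\<close> instead of the end point makes the attained and the infinite
  case alike, since a set without lower bound has elements below every number.
\<close>

lemma ext_min_le_iff:
  assumes "has_ext_min S"
  shows "ext_min S \<le> ereal z \<longleftrightarrow> (\<exists>s\<in>S. s \<le> z)"
proof (cases "bdd_below S")
  case True
  with assms obtain m where m: "m \<in> S" "\<And>s. s \<in> S \<Longrightarrow> m \<le> s"
    unfolding has_ext_min_def by blast
  then have "(LEAST s. s \<in> S) = m" by (intro Least_equality)
  with True have "ext_min S = ereal m" unfolding ext_min_def by simp
  with m show ?thesis by (auto intro: order_trans)
next
  case False
  then have "\<exists>s\<in>S. s \<le> z" unfolding bdd_below_def by (meson linear)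
  with False show ?thesis unfolding ext_min_def by simp
qed

lemma le_ext_max_iff:
  assumes "has_ext_max S"
  shows "ereal z \<le> ext_max S \<longleftrightarrow> (\<exists>s\<in>S. z \<le> s)"
proof (cases "bdd_above S")
  case True
  with assms obtain m where m: "m \<in> S" "\<And>s. s \<in> S \<Longrightarrow> s \<le> m"
    unfolding has_ext_max_def by blast
  then have "(GREATEST s. s \<in> S) = m" by (intro Greatest_equality)
  with True have "ext_max S = ereal m" unfolding ext_max_def by simp
  with m show ?thesis by (auto intro: order_trans)
next
  case False
  then have "\<exists>s\<in>S. z \<le> s" unfolding bdd_above_def by (meson linear)
  with False show ?thesis unfolding ext_max_def by simp
qed

lemma mem_iff_between_ext_min_ext_max:
  assumes "is_interval S" "has_ext_min S" "has_ext_max S"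
  shows "z \<in> S \<longleftrightarrow> ext_min S \<le> ereal z \<and> ereal z \<le> ext_max S"
  unfolding ext_min_le_iff[OF assms(2)] le_ext_max_iff[OF assms(3)]
  using assms(1) unfolding is_interval_1 by blast

theorem proposition6:
  fixes n m :: nat
    and I\<^sub>1 I\<^sub>2 J\<^sub>1 J\<^sub>2 :: "nat set"
    and DI\<^sub>1 DI\<^sub>2 :: "(nat \<Rightarrow> real) set"
    and q :: "nat \<Rightarrow> (nat \<Rightarrow> real) \<Rightarrow> real \<Rightarrow> real"
    and q\<^sub>0 h\<^sub>1 :: "(nat \<Rightarrow> real) \<Rightarrow> real \<Rightarrow> real"
    and h\<^sub>2 :: "(nat \<Rightarrow> real) \<Rightarrow> real"
    and z\<^sub>0 :: real
  assumes "I\<^sub>1 \<union> I\<^sub>2 = {1..n}" "I\<^sub>1 \<inter> I\<^sub>2 = {}"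
    and "J\<^sub>1 \<union> J\<^sub>2 = {1..m}" "J\<^sub>1 \<inter> J\<^sub>2 = {}"
    and "DI\<^sub>1 \<subseteq> vecs I\<^sub>1" "DI\<^sub>2 \<subseteq> vecs I\<^sub>2"
    and "\<And>i. i \<in> J\<^sub>1 \<Longrightarrow> continuous_on (vecs I\<^sub>1 \<times> UNIV) (\<lambda>(x, z). q i x z)"
    and "\<And>i. i \<in> J\<^sub>2 \<Longrightarrow> continuous_on (vecs I\<^sub>2 \<times> UNIV) (\<lambda>(x, z). q i x z)"
    and "continuous_on (DI\<^sub>1 \<times> UNIV) (\<lambda>(x, z). h\<^sub>1 x z)"
    and "continuous_on DI\<^sub>2 h\<^sub>2"
    and "\<And>i x. i \<in> J\<^sub>2 \<Longrightarrow> x \<in> vecs I\<^sub>2 \<Longrightarrow> quasiconvex_on UNIV (\<lambda>z. q i x z)"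
    and "\<And>i x. i \<in> J\<^sub>2 \<Longrightarrow> x \<in> DI\<^sub>2 \<Longrightarrow> q i x z\<^sub>0 \<le> 0"
    and "\<And>y. y \<in> h\<^sub>2 ` DI\<^sub>2 \<Longrightarrow> has_ext_min (G_set DI\<^sub>2 h\<^sub>2 J\<^sub>2 q y)"
    and "\<And>y. y \<in> h\<^sub>2 ` DI\<^sub>2 \<Longrightarrow> has_ext_max (G_set DI\<^sub>2 h\<^sub>2 J\<^sub>2 q y)"
  shows "opt_value
           {(x\<^sub>1, x\<^sub>2, y\<^sub>1, y\<^sub>2). x\<^sub>1 \<in> DI\<^sub>1 \<and> x\<^sub>2 \<in> DI\<^sub>2
              \<and> (\<forall>i\<in>J\<^sub>1. q i x\<^sub>1 y\<^sub>2 \<le> 0) \<and> (\<forall>i\<in>J\<^sub>2. q i x\<^sub>2 y\<^sub>1 \<le> 0)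
              \<and> y\<^sub>1 = h\<^sub>1 x\<^sub>1 y\<^sub>2 \<and> y\<^sub>2 = h\<^sub>2 x\<^sub>2}
           (\<lambda>(x\<^sub>1, x\<^sub>2, y\<^sub>1, y\<^sub>2). q\<^sub>0 x\<^sub>1 y\<^sub>2)
       = opt_value
           {(x\<^sub>1, y\<^sub>2). x\<^sub>1 \<in> DI\<^sub>1 \<and> y\<^sub>2 \<in> h\<^sub>2 ` DI\<^sub>2
              \<and> (\<forall>i\<in>J\<^sub>1. q i x\<^sub>1 y\<^sub>2 \<le> 0)
              \<and> ext_min (G_set DI\<^sub>2 h\<^sub>2 J\<^sub>2 q y\<^sub>2) \<le> ereal (h\<^sub>1 x\<^sub>1 y\<^sub>2)
              \<and> ereal (h\<^sub>1 x\<^sub>1 y\<^sub>2) \<le> ext_max (G_set DI\<^sub>2 h\<^sub>2 J\<^sub>2 q y\<^sub>2)}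
           (\<lambda>(x\<^sub>1, y\<^sub>2). q\<^sub>0 x\<^sub>1 y\<^sub>2)"
proof -
  let ?F = "{(x\<^sub>1, x\<^sub>2, y\<^sub>1, y\<^sub>2). x\<^sub>1 \<in> DI\<^sub>1 \<and> x\<^sub>2 \<in> DI\<^sub>2
              \<and> (\<forall>i\<in>J\<^sub>1. q i x\<^sub>1 y\<^sub>2 \<le> 0) \<and> (\<forall>i\<in>J\<^sub>2. q i x\<^sub>2 y\<^sub>1 \<le> 0)
              \<and> y\<^sub>1 = h\<^sub>1 x\<^sub>1 y\<^sub>2 \<and> y\<^sub>2 = h\<^sub>2 x\<^sub>2}"
  let ?G = "G_set DI\<^sub>2 h\<^sub>2 J\<^sub>2 q"
  let ?H = "{(x\<^sub>1, y\<^sub>2). x\<^sub>1 \<in> DI\<^sub>1 \<and> y\<^sub>2 \<in> h\<^sub>2 ` DI\<^sub>2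
              \<and> (\<forall>i\<in>J\<^sub>1. q i x\<^sub>1 y\<^sub>2 \<le> 0)
              \<and> ext_min (?G y\<^sub>2) \<le> ereal (h\<^sub>1 x\<^sub>1 y\<^sub>2)
              \<and> ereal (h\<^sub>1 x\<^sub>1 y\<^sub>2) \<le> ext_max (?G y\<^sub>2)}"
  let ?p = "\<lambda>(x\<^sub>1, x\<^sub>2 :: nat \<Rightarrow> real, y\<^sub>1 :: real, y\<^sub>2 :: real). (x\<^sub>1 :: nat \<Rightarrow> real, y\<^sub>2)"
  have "is_interval (?G y)" for y
    using assms(6,11,12) by (intro is_interval_G_set) blast+
  then have mem_G: "z \<in> ?G y \<longleftrightarrow> ext_min (?G y) \<le> ereal z \<and> ereal z \<le> ext_max (?G y)"
    if "y \<in> h\<^sub>2 ` DI\<^sub>2" for y z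
    using assms(13,14) that by (intro mem_iff_between_ext_min_ext_max)
  have "?H = {(x\<^sub>1, y\<^sub>2). x\<^sub>1 \<in> DI\<^sub>1 \<and> y\<^sub>2 \<in> h\<^sub>2 ` DI\<^sub>2
              \<and> (\<forall>i\<in>J\<^sub>1. q i x\<^sub>1 y\<^sub>2 \<le> 0) \<and> h\<^sub>1 x\<^sub>1 y\<^sub>2 \<in> ?G y\<^sub>2}"
    using mem_G by blast
  also have "\<dots> = ?p ` ?F"
    unfolding G_set_def by (force simp: image_iff)
  finally have "opt_value ?H (\<lambda>(x\<^sub>1, y\<^sub>2). q\<^sub>0 x\<^sub>1 y\<^sub>2)
      = opt_value ?F (\<lambda>v. case ?p v of (x\<^sub>1, y\<^sub>2) \<Rightarrow> q\<^sub>0 x\<^sub>1 y\<^sub>2)"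
    by (simp only: opt_value_image)
  then show ?thesis by (simp add: case_prod_unfold)
qed

end
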